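(* Let $k\geq 2$. For integers $0\le i<j$ put $\beta_{i,j}=jx\prod_{s=i+1}^{j-1}(sx-1)$ (an empty product equals $1$), and put $\beta_{j,j}=1$. Let $\mathcal{N}_{k,1}(n)$ be the set of $(k,1)$-noncrossing partitions of $[n]$. Then \[ \sum_{n\geq 0}\#\mathcal{N}_{k,1}(n)x^{n}=\frac{1-x+(1-x)\sum_{j=1}^{k-2}\sum_{i=0}^{j}(-1)^{i+j}x^{i}\beta_{i,j}+\sum_{i=0}^{k-1}(-1)^{i+k-1}x^{i}\beta_{i,k-1}}{1-x-x(1-x)\sum_{j=1}^{k-2}\sum_{i=0}^{j}(-1)^{i+j}i\beta_{i,j}-x\sum_{i=0}^{k-1}(-1)^{i+k-1}i\beta_{i,k-1}}. \]
   Context: A set partition of $[n]=\{1,\dots,n\}$ is identified with its canonical sequential form $\pi_1\pi_2\cdots\pi_n$: list the blocks $B_1,\dots,B_d$ in increasing order of their minimum elements and set $\pi_i=m$ iff $i\in B_m$ (the empty word is the unique partition of $[0]$). The reduced form of a word over letters $a_1<\dots<a_d$ is obtained by renaming $a_i$ as $i$. A partition $\pi$ avoids a word $\tau$ if no subsequence of $\pi$ has the same reduced form as $\tau$. A partition is $(k,1)$-noncrossing if it avoids $12\cdots k1$. *)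

theory Defs
  imports
    "HOL-Library.Disjoint_Sets"
    "HOL-Library.Sublist"
    "HOL-Computational_Algebra.Formal_Power_Series"
begin

definition ordered_blocks :: "nat set set \<Rightarrow> nat set list" where
  "ordered_blocks P = (THE Bs. set Bs = P \<and> sorted_wrt (\<lambda>A B. Min A < Min B) Bs)"

lemma ordered_blocks_unique:
  fixes n :: nat
  assumes "partition_on {1..n} P"
  shows "\<exists>!Bs. set Bs = P \<and> sorted_wrt (\<lambda>A B. Min A < Min B) Bs"
proof -
  have fin: "finite P"
    using assms by (auto intro: finite_elements)
  have blk: "finite B \<and> B \<noteq> {}" if "B \<in> P" for B
    using assms that partition_onD3[OF assms] partition_onD1[OF assms]
    by (metis Union_upper finite_atLeastAtMost finite_subset)
  have inj: "inj_on Min P"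
  proof (rule inj_onI)
    fix A B assume AB: "A \<in> P" "B \<in> P" "Min A = Min B"
    then have "Min A \<in> A \<inter> B"
      using blk by (metis IntI Min_in)
    then show "A = B"
      using AB partition_onD2[OF assms] by (metis disjointD emptyE)
  qed
  define f where "f = the_inv_into P Min"
  have f: "f (Min B) = B" if "B \<in> P" for B
    using inj that by (simp add: f_def the_inv_into_f_f)
  have *: "sorted_wrt (<) (map Min Bs) \<longleftrightarrow> sorted_wrt (\<lambda>A B. Min A < Min B) Bs"
    for Bs :: "nat set list"
    by (simp add: sorted_wrt_map)
  show ?thesis
  proof (rule ex1I)
    let ?Bs = "map f (sorted_list_of_set (Min ` P))"
    have "map Min ?Bs = sorted_list_of_set (Min ` P)"
      unfolding map_map using fin f by (intro map_idI) auto
    then have "sorted_wrt (<) (map Min ?Bs)"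
      by simp
    moreover have "set ?Bs = P"
      using fin f by (auto simp: image_image)
    ultimately show "set ?Bs = P \<and> sorted_wrt (\<lambda>A B. Min A < Min B) ?Bs"
      using * by blast
  next
    fix Bs assume Bs: "set Bs = P \<and> sorted_wrt (\<lambda>A B. Min A < Min B) Bs"
    then have "sorted_wrt (<) (map Min Bs)" "set (map Min Bs) = Min ` P"
      using * by auto
    then have "map Min Bs = sorted_list_of_set (Min ` P)"
      using fin
      by (metis finite_imageI strict_sorted_equal set_sorted_list_of_set strict_sorted_list_of_set)
    moreover have "map f (map Min Bs) = Bs"
      using Bs f unfolding map_map by (intro map_idI) auto
    ultimately show "Bs = map f (sorted_list_of_set (Min ` P))"
      by simp
  qed
qed

text \<open>
  List positions start at 0 while blocks are numbered from 1: block number \<open>m\<close> of \<open>P\<close> is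
  \<open>ordered_blocks P ! (m - 1)\<close>.
\<close>
definition canonical_form :: "nat \<Rightarrow> nat set set \<Rightarrow> nat list" where
  "canonical_form n P =
     map (\<lambda>i. THE m. m \<in> {1..card P} \<and> i \<in> ordered_blocks P ! (m - 1)) [1..<n+1]"

text \<open>The letter \<open>a\<^sub>i\<close>, the \<open>i\<close>-th smallest one of \<open>w\<close>, has exactly \<open>i\<close> letters of \<open>w\<close> below or equal to it.\<close>
definition reduced_form :: "nat list \<Rightarrow> nat list" where
  "reduced_form w = map (\<lambda>a. card {b \<in> set w. b \<le> a}) w"

definition avoids :: "nat list \<Rightarrow> nat list \<Rightarrow> bool" where
  "avoids w \<tau> \<longleftrightarrow> \<not> (\<exists>s. subseq s w \<and> reduced_form s = reduced_form \<tau>)"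

definition noncrossing_k1 :: "nat \<Rightarrow> nat \<Rightarrow> nat set set set" where
  "noncrossing_k1 k n =
     {P. partition_on {1..n} P \<and> avoids (canonical_form n P) ([1..<k+1] @ [1])}"

text \<open>The variable \<open>x\<close> is \<open>fps_X\<close>. Only the arguments \<open>i \<le> j\<close> are meaningful.\<close>
definition \<beta> :: "nat \<Rightarrow> nat \<Rightarrow> rat fps" where
  "\<beta> i j = (if i = j then 1
            else of_nat j * fps_X * (\<Prod>s\<in>{i+1..j-1}. (of_nat s * fps_X - 1)))"

end

theory Submission
  imports Defs
begin

text \<open>
  Canonical forms of partitions are exactly the restricted growth words, and the letter \<open>a\<close> may be
  appended to such a word with maximal letter \<open>m\<close> without creating the pattern \<open>12\<dots>k1\<close> iff
  \<open>a \<ge> m + 2 - k\<close>. So the series \<open>F\<^sub>m\<close> of the avoiding words with maximal letter \<open>m < k\<close> satisfies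
  \<open>F\<^sub>m = x F\<^sub>m\<^sub>-\<^sub>1 / (1 - m x)\<close>, and those with larger \<open>m\<close> contribute a geometric series. On the other
  side, each alternating sum over \<open>i\<close> of the \<open>\<beta> i j\<close> is a difference
  \<open>R\<^sub>j - R\<^sub>j\<^sub>-\<^sub>1\<close>, where \<open>R\<^sub>j = (\<Sum>i\<le>j. f\<^sub>i (1 - (i+1) x) \<cdots> (1 - j x))\<close>, so that the double sums
  telescope.
\<close>

subsection \<open>The pattern\<close>

lemma reduced_form_nth:
  fixes xs :: "nat list"
  assumes "sorted_wrt (<) xs" "i < length xs"
  shows "card {b \<in> set xs. b \<le> xs ! i} = Suc i"
proof -
  have "{b \<in> set xs. b \<le> xs ! i} = (!) xs ` {..i}"
  proof -
    have "xs ! j \<le> xs ! i \<longleftrightarrow> j \<le> i" if "j < length xs" for j :: nat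
      using assms(2) that sorted_wrt_nth_less[OF assms(1), of i j]
        sorted_wrt_nth_less[OF assms(1), of j i]
      by (cases i j rule: linorder_cases) auto
    then show ?thesis
      using assms(2) by (fastforce simp: set_conv_nth image_iff)
  qed
  moreover have "inj_on ((!) xs) {..i}"
    using assms by (auto simp: inj_on_def strict_sorted_iff nth_eq_iff_index_eq)
  ultimately show ?thesis
    by (simp add: card_image)
qed

text \<open>The rank of a letter is strictly monotone on the letters of a word, so the reduced form
  records exactly the comparisons between positions. Occurrences of the pattern thus become
  increasing words closed by their own first letter.\<close>

lemma reduced_form_eq_iff:
  assumes "k \<ge> 1"
  shows "reduced_form s = [1..<k+1] @ [1] \<longleftrightarrow>
    (\<exists>xs. length xs = k \<and> sorted_wrt (<) xs \<and> s = xs @ [hd xs])"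
proof
  define r where "r a = card {b \<in> set s. b \<le> a}" for a
  have r: "a < b" if "r a < r b" for a b
  proof (rule ccontr)
    assume "\<not> a < b"
    then have "r b \<le> r a"
      unfolding r_def by (intro card_mono) auto
    with that show False by simp
  qed
  \<comment> \<open>Strict because \<open>b\<close>, being a letter of \<open>s\<close>, counts
    towards its own rank but not towards that of \<open>a\<close>.\<close>
  have r': "r a < r b" if "a < b" "b \<in> set s" for a b
    unfolding r_def
  proof (intro psubset_card_mono psubsetI)
    have "b \<in> {c \<in> set s. c \<le> b} - {c \<in> set s. c \<le> a}"
      using that by simp
    then show "{c \<in> set s. c \<le> a} \<noteq> {c \<in> set s. c \<le> b}"
      by blast
  qed (use that in auto)
  assume "reduced_form s = [1..<k+1] @ [1]"
  then have *: "map r s = [1..<k+1] @ [1]"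
    by (simp add: reduced_form_def r_def[abs_def])
  then obtain xs b where s: "s = xs @ [b]"
    by (cases s rule: rev_cases) simp_all
  then have map_xs: "map r xs = [1..<k+1]" and b: "r b = 1"
    using * by (simp_all del: upt_Suc)
  have len: "length xs = k"
    using arg_cong[OF map_xs, of length] by simp
  have "sorted_wrt (<) (map r xs)"
    unfolding map_xs by (rule sorted_wrt_upt)
  then have "sorted_wrt (<) xs"
    unfolding sorted_wrt_map by (rule sorted_wrt_mono_rel[rotated]) (rule r)
  moreover have "xs \<noteq> []"
    using len assms by auto
  have "r (hd xs) = 1"
    using arg_cong[OF map_xs, of hd] assms \<open>xs \<noteq> []\<close> by (simp add: hd_map del: upt_Suc)
  then have "hd xs = b"
    using r'[of "hd xs" b] r'[of b "hd xs"] s b \<open>xs \<noteq> []\<close>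
    by (cases "hd xs" b rule: linorder_cases) auto
  ultimately show "\<exists>xs. length xs = k \<and> sorted_wrt (<) xs \<and> s = xs @ [hd xs]"
    using s len by blast
next
  assume "\<exists>xs. length xs = k \<and> sorted_wrt (<) xs \<and> s = xs @ [hd xs]"
  then obtain xs where xs: "length xs = k" "sorted_wrt (<) xs" "s = xs @ [hd xs]"
    by blast
  have "xs \<noteq> []"
    using xs assms by auto
  then have set: "set s = set xs"
    using xs by auto
  have "map (\<lambda>a. card {b \<in> set xs. b \<le> a}) xs = [1..<k+1]"
    by (rule nth_equalityI) (use reduced_form_nth[OF xs(2)] xs in \<open>auto simp del: upt_Suc\<close>)
  moreover have "card {b \<in> set xs. b \<le> hd xs} = 1"
    using reduced_form_nth[OF xs(2), of 0] \<open>xs \<noteq> []\<close> by (simp add: hd_conv_nth)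
  ultimately show "reduced_form s = [1..<k+1] @ [1]"
    using set by (simp add: reduced_form_def xs(3))
qed

lemma avoids_iff:
  assumes "k \<ge> 1"
  shows "avoids w ([1..<k+1] @ [1]) \<longleftrightarrow>
    \<not> (\<exists>xs. length xs = k \<and> sorted_wrt (<) xs \<and> subseq (xs @ [hd xs]) w)"
proof -
  have "reduced_form ([1..<k+1] @ [1]) = [1..<k+1] @ [1]"
    unfolding reduced_form_eq_iff[OF assms]
    using assms by (intro exI[of _ "[1..<k+1]"]) (auto simp del: upt_Suc)
  then show ?thesis
    unfolding avoids_def using reduced_form_eq_iff[OF assms] by metis
qed

subsection \<open>Restricted growth words\<close>

lemma interval_subset_iff: "{1..<a} \<subseteq> {1..m} \<longleftrightarrow> a \<le> Suc m" for a m :: nat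
proof
  assume *: "{1..<a} \<subseteq> {1..m}"
  show "a \<le> Suc m"
  proof (rule ccontr)
    assume "\<not> a \<le> Suc m"
    then have "Suc m \<in> {1..<a}"
      by simp
    with * show False
      by fastforce
  qed
qed auto

lemma subseq_snocD: "subseq (xs @ [x]) w \<Longrightarrow> subseq xs w"
  by (meson subseq_order.trans subseq_rev_drop_many subseq_order.refl)

lemma subseq_snoc_iff:
  "subseq (xs @ [x]) (w @ [a]) \<longleftrightarrow> (if x = a then subseq xs w else subseq (xs @ [x]) w)"
proof (cases "x = a")
  case False
  have "subseq (xs @ [x]) w" if "subseq (xs @ [x]) (w @ [a])"
    using that
  proof (cases rule: subseq_appendE)
    case (append xs1 xs2)
    then have "length xs2 \<le> 1"
      using list_emb_length by fastforce
    then have "xs2 = [] \<or> (\<exists>z. xs2 = [z])"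
      by (cases xs2) auto
    then show ?thesis
      using append False by (auto split: if_splits)
  qed
  with False show ?thesis
    using subseq_rev_drop_many by auto
qed simp

text \<open>The familiar form, in which each letter exceeds the previous maximum by at most one, is
  recovered in \<open>restricted_growth_snoc_iff\<close>.\<close>

definition restricted_growth :: "nat list \<Rightarrow> bool" where
  "restricted_growth w \<longleftrightarrow> (\<forall>i<length w. 0 < w ! i \<and> {1..<w ! i} \<subseteq> set (take i w))"

lemma restricted_growth_Nil [simp]: "restricted_growth []"
  by (simp add: restricted_growth_def)

lemma restricted_growth_snoc:
  "restricted_growth (w @ [a]) \<longleftrightarrow> restricted_growth w \<and> 0 < a \<and> {1..<a} \<subseteq> set w"
  by (auto simp: restricted_growth_def nth_append less_Suc_eq)

lemma restricted_growth_pos: "restricted_growth w \<Longrightarrow> m \<in> set w \<Longrightarrow> 0 < m"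
  by (auto simp: restricted_growth_def in_set_conv_nth)

text \<open>Each letter is at most one above the current maximum, so no gap can arise. Hence
  \<open>card (set w)\<close> is the maximal letter, with value 0 for the empty word.\<close>

lemma set_restricted_growth:
  "restricted_growth w \<Longrightarrow> set w = {1..card (set w)}"
proof (induction w rule: rev_induct)
  case (snoc a w)
  define m where "m = card (set w)"
  have w: "set w = {1..m}" and a: "0 < a" "{1..<a} \<subseteq> {1..m}"
    using snoc by (auto simp: restricted_growth_snoc m_def)
  have "a \<le> Suc m"
    using a(2) by (simp only: interval_subset_iff)
  then have "insert a {1..m} = {1..max m a}"
    using a(1) by auto
  then have E: "set (w @ [a]) = {1..max m a}"
    by (simp add: w)
  show ?case
    unfolding E by simp
qed simp

lemma restricted_growth_snoc_iff:
  "restricted_growth (w @ [a]) \<longleftrightarrow> restricted_growth w \<and> a \<in> {1..Suc (card (set w))}"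
proof (cases "restricted_growth w")
  case True
  have "{1..<a} \<subseteq> set w \<longleftrightarrow> a \<le> Suc (card (set w))"
    by (subst set_restricted_growth[OF True]) (rule interval_subset_iff)
  with True show ?thesis
    by (auto simp: restricted_growth_snoc)
qed (simp add: restricted_growth_snoc)

lemma card_set_snoc:
  assumes "restricted_growth (w @ [a])"
  shows "card (set (w @ [a])) = max (card (set w)) a"
proof -
  have w: "set w = {1..card (set w)}" and a: "a \<in> {1..Suc (card (set w))}"
    using assms set_restricted_growth by (auto simp: restricted_growth_snoc_iff)
  have "insert a (set w) = {1..max (card (set w)) a}"
    using a by (subst w) auto
  then show ?thesis
    by simp
qed

text \<open>A letter that raises the maximum raises it by exactly one and extends the increasing
  subsequence; any other letter can be skipped.\<close>

lemma subseq_upt_restricted_growth: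
  "restricted_growth w \<Longrightarrow> subseq [1..<Suc (card (set w))] w"
proof (induction w rule: rev_induct)
  case (snoc a w)
  then have IH: "subseq [1..<Suc (card (set w))] w" and a: "a \<le> Suc (card (set w))"
    by (auto simp: restricted_growth_snoc_iff)
  show ?case
  proof (cases "a \<le> card (set w)")
    case True
    then show ?thesis
      unfolding card_set_snoc[OF snoc.prems] using IH True
      by (simp add: max_absorb1 subseq_rev_drop_many del: upt_Suc)
  next
    case False
    then have "a = Suc (card (set w))"
      using a by simp
    then show ?thesis
      unfolding card_set_snoc[OF snoc.prems] using IH
      by (simp add: max_absorb2 list_emb_append_mono)
  qed
qed simp

text \<open>Since the first occurrences of the letters of a restricted growth word appear in increasing
  order, appending \<open>a\<close> completes the pattern iff the maximal letter is at least \<open>a + k - 1\<close>.\<close>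
lemma avoids_snoc_iff:
  assumes "k \<ge> 1" and rg: "restricted_growth (w @ [a])"
  shows "avoids (w @ [a]) ([1..<k+1] @ [1]) \<longleftrightarrow>
    avoids w ([1..<k+1] @ [1]) \<and> card (set w) + 2 \<le> a + k"
proof -
  define m where "m = card (set w)"
  have w: "restricted_growth w" "1 \<le> a"
    using rg by (auto simp: restricted_growth_snoc_iff)
  have setw: "set w = {1..m}"
    using set_restricted_growth[OF w(1)] by (simp add: m_def)
  define C where "C xs \<longleftrightarrow> length xs = k \<and> sorted_wrt (<) xs" for xs :: "nat list"
  \<comment> \<open>An occurrence of the pattern either lies inside \<open>w\<close> or uses the
    final \<open>a\<close> as its closing letter, and then its increasing part lies in
    \<open>w\<close> and begins with \<open>a\<close>.\<close>
  have split: "(\<exists>xs. C xs \<and> subseq (xs @ [hd xs]) (w @ [a])) \<longleftrightarrow>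
      (\<exists>xs. C xs \<and> subseq (xs @ [hd xs]) w) \<or> (\<exists>xs. C xs \<and> hd xs = a \<and> subseq xs w)"
  proof -
    have "C xs \<and> subseq (xs @ [hd xs]) (w @ [a]) \<longleftrightarrow>
        C xs \<and> subseq (xs @ [hd xs]) w \<or> C xs \<and> hd xs = a \<and> subseq xs w" for xs
      using subseq_snoc_iff[of xs "hd xs" w a] subseq_snocD[of xs "hd xs" w] by auto
    then show ?thesis
      by blast
  qed
  have "(\<exists>xs. C xs \<and> hd xs = a \<and> subseq xs w) \<longleftrightarrow> a + k \<le> m + 1"
  proof
    assume "\<exists>xs. C xs \<and> hd xs = a \<and> subseq xs w"
    then obtain xs where xs: "C xs" "hd xs = a" "subseq xs w"
      by blast
    \<comment> \<open>The \<open>k\<close> distinct letters of \<open>xs\<close> lie between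
      \<open>a\<close> and \<open>m\<close>, so this interval has at least \<open>k\<close>
      elements.\<close>
    have "set xs \<subseteq> {1..m}"
      unfolding setw[symmetric] using list_emb_set[OF xs(3)] by blast
    moreover have "\<forall>x\<in>set xs. a \<le> x"
      using xs by (cases xs) (auto simp: C_def)
    ultimately have "set xs \<subseteq> {a..m}"
      by auto
    then have "card (set xs) \<le> card {a..m}"
      by (intro card_mono) auto
    moreover have "card (set xs) = k"
      using xs by (auto simp: C_def strict_sorted_iff distinct_card)
    ultimately show "a + k \<le> m + 1"
      using assms(1) by simp
  next
    \<comment> \<open>The consecutive letters from \<open>a\<close> to \<open>a + k - 1\<close> are
      a witness, being part of the subsequence \<open>1, ..., m\<close> of \<open>w\<close>.\<close>
    assume le: "a + k \<le> m + 1"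
    then have "[1..<Suc m] = [1..<a] @ [a..<a+k] @ [a+k..<Suc m]"
      using w(2) upt_add_eq_append[of 1 a "Suc m - a"] upt_add_eq_append[of a "a + k" "Suc m - (a + k)"]
      by (simp del: upt_Suc)
    then have "subseq [a..<a+k] [1..<Suc m]"
      by (simp add: subseq_drop_many subseq_rev_drop_many del: upt_Suc)
    moreover have "subseq [1..<Suc m] w"
      using subseq_upt_restricted_growth[OF w(1)] by (simp add: m_def)
    ultimately have "subseq [a..<a+k] w"
      by (rule subseq_order.trans)
    moreover have "C [a..<a+k]" "hd [a..<a+k] = a"
      using assms(1) by (auto simp: C_def simp del: upt_Suc)
    ultimately show "\<exists>xs. C xs \<and> hd xs = a \<and> subseq xs w"
      by blast
  qed
  then show ?thesis
    unfolding avoids_iff[OF assms(1)] m_def[symmetric]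
    using split unfolding C_def by (auto simp: not_le simp del: upt_Suc)
qed

subsection \<open>Canonical forms\<close>

lemma ordered_blocks:
  assumes "partition_on {1..n} P"
  shows "set (ordered_blocks P) = P" "sorted_wrt (\<lambda>A B. Min A < Min B) (ordered_blocks P)"
  using theI'[OF ordered_blocks_unique[OF assms]] unfolding ordered_blocks_def[symmetric] by blast+

lemma sorted_wrt_Min_distinct:
  "sorted_wrt (\<lambda>A B. Min A < Min B) Bs \<Longrightarrow> distinct Bs" for Bs :: "nat set list"
  by (induction Bs) auto

lemma length_ordered_blocks:
  "partition_on {1..n} P \<Longrightarrow> length (ordered_blocks P) = card P"
  using ordered_blocks(1)[of n P] distinct_card[OF sorted_wrt_Min_distinct[OF ordered_blocks(2)[of n P]]]
  by simp

text \<open>Justifies the definite description in \<open>canonical_form\<close>: blocks cover the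
  ground set, are disjoint, and are listed without repetition.\<close>

lemma ex1_block_index:
  assumes P: "partition_on {1..n} P" and i: "i \<in> {1..n}"
  shows "\<exists>!m. m \<in> {1..card P} \<and> i \<in> ordered_blocks P ! (m - 1)"
proof (rule ex_ex1I)
  let ?Bs = "ordered_blocks P"
  obtain B where "B \<in> set ?Bs" "i \<in> B"
    using i unfolding partition_onD1[OF P] ordered_blocks(1)[OF P] by blast
  then obtain l where "l < length ?Bs" "?Bs ! l = B"
    by (auto simp: in_set_conv_nth)
  then show "\<exists>m. m \<in> {1..card P} \<and> i \<in> ?Bs ! (m - 1)"
    using \<open>i \<in> B\<close> by (intro exI[of _ "Suc l"]) (auto simp: length_ordered_blocks[OF P])
next
  let ?Bs = "ordered_blocks P"
  fix l m
  assume l: "l \<in> {1..card P} \<and> i \<in> ?Bs ! (l - 1)" and m: "m \<in> {1..card P} \<and> i \<in> ?Bs ! (m - 1)"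
  then have len: "l - 1 < length ?Bs" "m - 1 < length ?Bs"
    by (auto simp: length_ordered_blocks[OF P])
  then have "?Bs ! (l - 1) \<in> P" "?Bs ! (m - 1) \<in> P"
    using ordered_blocks(1)[OF P] nth_mem by blast+
  then have "?Bs ! (l - 1) = ?Bs ! (m - 1)"
    using l m partition_onD2[OF P] by (auto dest: disjointD)
  moreover have "distinct ?Bs"
    using ordered_blocks(2)[OF P] by (rule sorted_wrt_Min_distinct)
  ultimately have "l - 1 = m - 1"
    using len nth_eq_iff_index_eq by blast
  then show "l = m"
    using l m by auto
qed

lemma length_canonical_form [simp]: "length (canonical_form n P) = n"
  by (simp add: canonical_form_def)

lemma canonical_form_nth_eq_iff:
  assumes P: "partition_on {1..n} P" and i: "i \<in> {1..n}"
  shows "canonical_form n P ! (i - 1) = m \<longleftrightarrow> m \<in> {1..card P} \<and> i \<in> ordered_blocks P ! (m - 1)"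
proof -
  have "canonical_form n P ! (i - 1) = (THE m. m \<in> {1..card P} \<and> i \<in> ordered_blocks P ! (m - 1))"
    using i unfolding canonical_form_def by (subst nth_map) (auto simp del: upt_Suc)
  then show ?thesis
    using theI'[OF ex1_block_index[OF P i]] the1_equality[OF ex1_block_index[OF P i]] by metis
qed

text \<open>Inverts the canonical form block by block. Elements are numbered from 1 and list
  positions from 0, hence the shift.\<close>

definition letter_block :: "nat list \<Rightarrow> nat \<Rightarrow> nat set" where
  "letter_block w m = {i \<in> {1..length w}. w ! (i - 1) = m}"

lemma letter_block_canonical_form:
  assumes P: "partition_on {1..n} P" and m: "m \<in> {1..card P}"
  shows "letter_block (canonical_form n P) m = ordered_blocks P ! (m - 1)"
proof -
  have "m - 1 < length (ordered_blocks P)"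
    using m by (auto simp: length_ordered_blocks[OF P])
  then have "ordered_blocks P ! (m - 1) \<in> P"
    using nth_mem ordered_blocks(1)[OF P] by metis
  then have sub: "ordered_blocks P ! (m - 1) \<subseteq> {1..n}"
    unfolding partition_onD1[OF P] by (rule Union_upper)
  show ?thesis
  proof (rule set_eqI)
    fix i
    show "i \<in> letter_block (canonical_form n P) m \<longleftrightarrow> i \<in> ordered_blocks P ! (m - 1)"
    proof (cases "i \<in> {1..n}")
      case True
      then show ?thesis
        using canonical_form_nth_eq_iff[OF P True, of m] m by (simp add: letter_block_def)
    next
      case False
      then show ?thesis
        using sub by (auto simp: letter_block_def)
    qed
  qed
qed

lemma letter_blocks_canonical_form:
  assumes P: "partition_on {1..n} P"
  shows "letter_block (canonical_form n P) ` {1..card P} = P"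
proof -
  have "letter_block (canonical_form n P) ` {1..card P} = (\<lambda>m. ordered_blocks P ! (m - 1)) ` {1..card P}"
    using letter_block_canonical_form[OF P] by (intro image_cong) auto
  also have "\<dots> = (\<lambda>m. ordered_blocks P ! (m - 1)) ` Suc ` {..<card P}"
    by (simp add: image_Suc_lessThan)
  also have "\<dots> = P"
    using ordered_blocks(1)[OF P] length_ordered_blocks[OF P]
    by (auto simp: set_conv_nth image_image)
  finally show ?thesis .
qed

lemma set_canonical_form:
  assumes P: "partition_on {1..n} P"
  shows "set (canonical_form n P) = {1..card P}"
proof
  show "set (canonical_form n P) \<subseteq> {1..card P}"
  proof
    fix m assume "m \<in> set (canonical_form n P)"
    then obtain i where "i < n" "canonical_form n P ! i = m"
      by (auto simp: in_set_conv_nth)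
    then show "m \<in> {1..card P}"
      using canonical_form_nth_eq_iff[OF P, of "Suc i" m] by simp
  qed
  show "{1..card P} \<subseteq> set (canonical_form n P)"
  proof
    fix m assume m: "m \<in> {1..card P}"
    then have "letter_block (canonical_form n P) m \<in> P"
      using letter_blocks_canonical_form[OF P] by blast
    then have "letter_block (canonical_form n P) m \<noteq> {}"
      using partition_onD3[OF P] by auto
    then obtain i where "i \<in> {1..n}" "canonical_form n P ! (i - 1) = m"
      by (auto simp: letter_block_def)
    then show "m \<in> set (canonical_form n P)"
      using nth_mem[of "i - 1" "canonical_form n P"] by auto
  qed
qed

text \<open>A partition is recovered from its word as the family of letter blocks.\<close>

lemma inj_on_canonical_form: "inj_on (canonical_form n) {P. partition_on {1..n} P}"
proof (rule inj_onI)
  fix P Q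
  assume "P \<in> {P. partition_on {1..n} P}" "Q \<in> {P. partition_on {1..n} P}"
    and eq: "canonical_form n P = canonical_form n Q"
  then have P: "partition_on {1..n} P" and Q: "partition_on {1..n} Q"
    by auto
  have "P = letter_block (canonical_form n P) ` set (canonical_form n P)"
    using letter_blocks_canonical_form[OF P] set_canonical_form[OF P] by simp
  also have "\<dots> = Q"
    unfolding eq using letter_blocks_canonical_form[OF Q] set_canonical_form[OF Q] by simp
  finally show "P = Q" .
qed

text \<open>A letter smaller than the one at a given position names a block with smaller minimum,
  and that minimum is an earlier position carrying the smaller letter.\<close>

lemma restricted_growth_canonical_form:
  assumes P: "partition_on {1..n} P"
  shows "restricted_growth (canonical_form n P)"
  unfolding restricted_growth_def
proof (intro allI impI conjI subsetI)
  let ?w = "canonical_form n P"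
  fix i assume "i < length ?w"
  then have i: "i < n" "Suc i \<in> {1..n}"
    by auto
  have m: "?w ! i \<in> {1..card P}"
    using set_canonical_form[OF P] nth_mem[of i ?w] i by auto
  then show "0 < ?w ! i"
    by simp
  fix l assume l: "l \<in> {1..<?w ! i}"
  then have l': "l \<in> {1..card P}"
    using m by auto
  have "Min (ordered_blocks P ! (l - 1)) < Min (ordered_blocks P ! (?w ! i - 1))"
    using sorted_wrt_nth_less[OF ordered_blocks(2)[OF P]] l m length_ordered_blocks[OF P] by auto
  then have less: "Min (letter_block ?w l) < Min (letter_block ?w (?w ! i))"
    using letter_block_canonical_form[OF P] l' m by simp
  have fin: "finite (letter_block ?w m)" for m
    by (simp add: letter_block_def)
  have "Suc i \<in> letter_block ?w (?w ! i)"
    using i by (simp add: letter_block_def)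
  then have "Min (letter_block ?w (?w ! i)) \<le> Suc i"
    using fin by simp
  moreover have "letter_block ?w l \<noteq> {}"
    using letter_blocks_canonical_form[OF P] partition_onD3[OF P] l' by (metis image_eqI)
  then have "Min (letter_block ?w l) \<in> letter_block ?w l"
    using fin by simp
  ultimately obtain j where "j \<in> letter_block ?w l" "j < Suc i"
    using less by fastforce
  then have "j - 1 < i" "?w ! (j - 1) = l"
    using i by (auto simp: letter_block_def)
  then show "l \<in> set (take i ?w)"
    using i by (auto simp: in_set_conv_nth intro!: exI[of _ "j - 1"])
qed

section \<open>From restricted growth words back to partitions\<close>

lemma partition_on_letter_blocks: "partition_on {1..length w} (letter_block w ` set w)"
proof (rule partition_onI)
  show "\<Union> (letter_block w ` set w) = {1..length w}"
    by (auto simp: letter_block_def)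
  have "p \<noteq> {}" if p_in: "p \<in> letter_block w ` set w" for p
  proof -
    obtain m where "m \<in> set w" and p: "p = letter_block w m"
      using p_in by blast
    then obtain i where "i < length w" "w ! i = m"
      by (auto simp: in_set_conv_nth)
    then have "Suc i \<in> p"
      by (simp add: p letter_block_def)
    then show "p \<noteq> {}"
      by blast
  qed
  then show "{} \<notin> letter_block w ` set w"
    by blast
  show "disjnt p q" if "p \<in> letter_block w ` set w" "q \<in> letter_block w ` set w" "p \<noteq> q" for p q
    using that by (auto simp: letter_block_def disjnt_def)
qed

text \<open>The first occurrence of a letter is preceded by all smaller letters, so the minima of
  the letter blocks increase with the letter and the numbering of blocks agrees with the
  letters.\<close>

lemma ordered_letter_blocks:
  assumes w: "restricted_growth w"
  shows "ordered_blocks (letter_block w ` set w) = map (letter_block w) [1..<Suc (card (set w))]"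
proof -
  have set: "set [1..<Suc (card (set w))] = set w"
    using set_restricted_growth[OF w, symmetric]
    by (simp add: atLeastLessThanSuc_atLeastAtMost del: upt_Suc)
  then have "set (map (letter_block w) [1..<Suc (card (set w))]) = letter_block w ` set w"
    by (simp only: set_map)
  moreover have "Min (letter_block w l) < Min (letter_block w m)" if "l < m" "l \<in> set w" "m \<in> set w" for l m
  proof -
    have fin: "finite (letter_block w m)" for m
      by (simp add: letter_block_def)
    have "letter_block w m \<noteq> {}"
      using partition_onD3[OF partition_on_letter_blocks, of w] that by (metis image_eqI)
    then have "Min (letter_block w m) \<in> letter_block w m"
      using fin by simp
    then obtain i where i: "Suc i = Min (letter_block w m)" "i < length w" "w ! i = m"
      by (auto simp: letter_block_def)
        (metis Suc_pred' less_eq_Suc_le One_nat_def)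
    have "l \<in> {1..<m}"
      using that restricted_growth_pos[OF w] by (simp add: Suc_le_eq)
    then have "l \<in> set (take i w)"
      using w i unfolding restricted_growth_def by blast
    then obtain j where "j < i" "w ! j = l"
      by (auto simp: in_set_conv_nth)
    then have "Suc j \<in> letter_block w l"
      using i by (simp add: letter_block_def)
    then have "Min (letter_block w l) \<le> Suc j"
      using fin by simp
    then show ?thesis
      using \<open>j < i\<close> i(1) by linarith
  qed
  then have "sorted_wrt (\<lambda>A B. Min A < Min B) (map (letter_block w) [1..<Suc (card (set w))])"
    unfolding sorted_wrt_map
    by (intro sorted_wrt_mono_rel[OF _ sorted_wrt_upt]) (simp only: set)
  ultimately show ?thesis
    unfolding ordered_blocks_def
    by (intro the1_equality[OF ordered_blocks_unique[OF partition_on_letter_blocks]] conjI)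
qed

lemma canonical_form_letter_blocks:
  assumes w: "restricted_growth w"
  shows "canonical_form (length w) (letter_block w ` set w) = w"
proof (rule nth_equalityI)
  let ?P = "letter_block w ` set w"
  note P = partition_on_letter_blocks[of w]
  have card: "card ?P = card (set w)"
    using length_ordered_blocks[OF P] ordered_letter_blocks[OF w] by (simp del: upt_Suc)
  fix i assume "i < length (canonical_form (length w) ?P)"
  then have i: "i < length w" "Suc i \<in> {1..length w}"
    by auto
  then have "w ! i \<in> {1..card (set w)}"
    using set_restricted_growth[OF w] nth_mem by blast
  moreover from this have "ordered_blocks ?P ! (w ! i - 1) = letter_block w (w ! i)"
    unfolding ordered_letter_blocks[OF w] by (subst nth_map) (auto simp del: upt_Suc)
  moreover have "Suc i \<in> letter_block w (w ! i)"
    using i by (simp add: letter_block_def)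
  ultimately show "canonical_form (length w) ?P ! i = w ! i"
    using canonical_form_nth_eq_iff[OF P i(2), of "w ! i"] card by simp
qed simp

lemma bij_betw_canonical_form:
  "bij_betw (canonical_form n) {P. partition_on {1..n} P} {w. length w = n \<and> restricted_growth w}"
proof (rule bij_betw_imageI[OF inj_on_canonical_form], intro equalityI subsetI)
  fix w assume "w \<in> {w. length w = n \<and> restricted_growth w}"
  then have w: "length w = n" "restricted_growth w"
    by simp_all
  have "letter_block w ` set w \<in> {P. partition_on {1..n} P}"
    using partition_on_letter_blocks[of w] w(1) by simp
  then show "w \<in> canonical_form n ` {P. partition_on {1..n} P}"
    using canonical_form_letter_blocks[OF w(2)] w(1) by (intro image_eqI) auto
qed (auto simp: restricted_growth_canonical_form simp del: One_nat_def)

subsection \<open>Telescoping of the coefficients\<close>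

text \<open>This is R_j of the introduction, used with \<open>f i = fps_X ^ i\<close> in the
  numerator and \<open>f i = of_nat i\<close> in the denominator.\<close>

definition weighted_sum :: "(nat \<Rightarrow> rat fps) \<Rightarrow> nat \<Rightarrow> rat fps" where
  "weighted_sum f j = (\<Sum>i\<le>j. f i * (\<Prod>s\<in>{i+1..j}. (1 - of_nat s * fps_X)))"

lemma weighted_sum_0 [simp]: "weighted_sum f 0 = f 0"
  by (simp add: weighted_sum_def)

lemma weighted_sum_Suc:
  "weighted_sum f (Suc j) = (1 - of_nat (Suc j) * fps_X) * weighted_sum f j + f (Suc j)"
proof -
  have "(\<Prod>s\<in>{i+1..Suc j}. (1 - of_nat s * fps_X :: rat fps)) =
      (1 - of_nat (Suc j) * fps_X) * (\<Prod>s\<in>{i+1..j}. (1 - of_nat s * fps_X))" if "i \<le> j" for i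
    using that by (subst prod.cl_ivl_Suc) (auto simp: mult.commute)
  then show ?thesis
    by (auto simp: weighted_sum_def sum_distrib_left mult_ac intro!: sum.cong)
qed

text \<open>Turning each factor \<open>s x - 1\<close> into \<open>1 - s x\<close> costs the sign
  (-1)^(j-i), and the total exponent 2j + 1 is odd.\<close>

lemma signed_beta:
  assumes "i \<le> j"
  shows "(-1)^(i + Suc j) * \<beta> i (Suc j) =
    - (of_nat (Suc j) * fps_X * (\<Prod>s\<in>{i+1..j}. (1 - of_nat s * fps_X)))"
proof -
  have "(\<Prod>s\<in>{i+1..j}. (of_nat s * fps_X - 1 :: rat fps)) =
      (\<Prod>s\<in>{i+1..j}. - 1 * (1 - of_nat s * fps_X))"
    by (simp add: algebra_simps)
  also have "\<dots> = (-1)^(j - i) * (\<Prod>s\<in>{i+1..j}. (1 - of_nat s * fps_X))"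
    by (subst prod.distrib) simp
  finally have *: "(\<Prod>s\<in>{i+1..j}. (of_nat s * fps_X - 1 :: rat fps)) =
      (-1)^(j - i) * (\<Prod>s\<in>{i+1..j}. (1 - of_nat s * fps_X))" .
  have "(-1)^(i + Suc j) * (-1)^(j - i) = (- 1 :: rat fps)"
    using assms by (simp flip: power_add)
  moreover have "\<beta> i (Suc j) = of_nat (Suc j) * fps_X * (\<Prod>s\<in>{i+1..j}. (of_nat s * fps_X - 1))"
    using assms by (simp add: \<beta>_def)
  moreover have "a * (c * (b * d)) = (a * b) * (c * d)" for a b c d :: "rat fps"
    by (rule mult.assoc[symmetric, THEN trans]) (simp add: mult_ac)
  ultimately show ?thesis
    unfolding * by simp
qed

text \<open>The diagonal term is \<open>f (Suc j)\<close> and the others add up to -(j+1) x R_j; by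
  \<open>weighted_sum_Suc\<close> this is the increment of R.\<close>

lemma signed_beta_sum:
  "(\<Sum>i=0..Suc j. (-1)^(i + Suc j) * f i * \<beta> i (Suc j)) =
    weighted_sum f (Suc j) - weighted_sum f j"
proof -
  have "(\<Sum>i=0..Suc j. (-1)^(i + Suc j) * f i * \<beta> i (Suc j)) =
      (\<Sum>i\<le>j. f i * ((-1)^(i + Suc j) * \<beta> i (Suc j))) + f (Suc j)"
    by (simp add: atLeast0AtMost \<beta>_def mult_ac flip: power_add mult_2)
  also have "(\<Sum>i\<le>j. f i * ((-1)^(i + Suc j) * \<beta> i (Suc j))) =
      - (of_nat (Suc j) * fps_X * weighted_sum f j)"
    unfolding weighted_sum_def sum_distrib_left sum_negf[symmetric]
    by (intro sum.cong refl, subst signed_beta) (auto simp: algebra_simps)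
  finally show ?thesis
    by (simp add: weighted_sum_Suc algebra_simps)
qed

text \<open>The increments telescope; as \<open>j\<close> starts at 1, the term R_0 =
  \<open>f 0\<close> is left over.\<close>

lemma signed_beta_double_sum:
  "(\<Sum>j=1..p. \<Sum>i=0..j. (-1)^(i+j) * f i * \<beta> i j) = weighted_sum f p - f 0"
proof (induction p)
  case (Suc p)
  have "(\<Sum>j=1..Suc p. \<Sum>i=0..j. (-1)^(i+j) * f i * \<beta> i j) =
      (\<Sum>j=1..p. \<Sum>i=0..j. (-1)^(i+j) * f i * \<beta> i j) +
      (\<Sum>i=0..Suc p. (-1)^(i + Suc p) * f i * \<beta> i (Suc p))"
    by (subst sum.cl_ivl_Suc) simp
  then show ?case
    by (simp only: Suc.IH signed_beta_sum) simp
qed simp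

text \<open>By the recurrence, 1 - x R_j is multiplied by 1 - (j+1) x when \<open>j\<close> grows by
  one, just like the product.\<close>

lemma weighted_sum_of_nat:
  "fps_X * weighted_sum of_nat j = 1 - (\<Prod>s\<in>{1..j}. (1 - of_nat s * fps_X))"
proof (induction j)
  case (Suc j)
  have "fps_X * weighted_sum of_nat (Suc j) =
      (1 - of_nat (Suc j) * fps_X) * (fps_X * weighted_sum of_nat j) + of_nat (Suc j) * fps_X"
    by (simp add: weighted_sum_Suc algebra_simps)
  then show ?case
    by (simp only: Suc.IH) (simp add: algebra_simps)
qed simp

subsection \<open>Generating functions by maximal letter\<close>

definition avoiding_words :: "nat \<Rightarrow> nat \<Rightarrow> nat list set" where
  "avoiding_words k n =
     {w. length w = n \<and> restricted_growth w \<and> avoids w ([1..<k+1] @ [1])}"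

definition words_max :: "nat \<Rightarrow> nat \<Rightarrow> nat \<Rightarrow> nat list set" where
  "words_max k n m = {w \<in> avoiding_words k n. card (set w) = m}"

lemma words_max_0: "k \<ge> 1 \<Longrightarrow> words_max k 0 m = (if m = 0 then {[]} else {})"
  unfolding words_max_def avoiding_words_def
  by (cases "m = 0") (auto simp only: avoids_iff, auto)

text \<open>Classify by the last letter. Either the maximum was already \<open>m\<close> and an old
  letter is repeated, subject to the avoidance bound, or the last letter is the first
  \<open>m\<close>, for which the bound always holds. The case \<open>m = 0\<close> is separate
  because of truncated subtraction.\<close>

lemma words_max_Suc:
  assumes "k \<ge> 1"
  shows "words_max k (Suc n) m =
    (\<lambda>(w, a). w @ [a]) ` (words_max k n m \<times> {a \<in> {1..m}. m + 2 \<le> a + k}) \<union>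
    (if m = 0 then {} else (\<lambda>w. w @ [m]) ` words_max k n (m - 1))" (is "_ = ?A \<union> ?B")
proof -
  have *: "w @ [a] \<in> words_max k (Suc n) m \<longleftrightarrow>
      w \<in> words_max k n m \<and> a \<in> {1..m} \<and> m + 2 \<le> a + k \<or>
      m > 0 \<and> a = m \<and> w \<in> words_max k n (m - 1)" for w a
  proof (cases "restricted_growth (w @ [a])")
    case True
    then show ?thesis
      using assms avoids_snoc_iff[OF assms True] card_set_snoc[OF True]
      by (auto simp: words_max_def avoiding_words_def restricted_growth_snoc_iff simp del: upt_Suc)
  next
    case False
    then show ?thesis
      by (auto simp: words_max_def avoiding_words_def restricted_growth_snoc_iff simp del: upt_Suc)
  qed
  show ?thesis
  proof (rule set_eqI)
    fix v
    show "v \<in> words_max k (Suc n) m \<longleftrightarrow> v \<in> ?A \<union> ?B"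
    proof (cases v rule: rev_cases)
      case Nil
      then show ?thesis
        by (auto simp: words_max_def avoiding_words_def)
    next
      case (snoc w a)
      then show ?thesis
        using * by auto
    qed
  qed
qed

lemma finite_words_max: "k \<ge> 1 \<Longrightarrow> finite (words_max k n m)"
proof (induction n arbitrary: m)
  case 0
  then show ?case by (simp add: words_max_0)
next
  case (Suc n)
  then show ?case by (simp add: words_max_Suc)
qed

lemma card_words_max_Suc:
  assumes "k \<ge> 1"
  shows "card (words_max k (Suc n) m) = min m (k - 1) * card (words_max k n m) +
    (if m = 0 then 0 else card (words_max k n (m - 1)))"
proof -
  let ?L = "{a \<in> {1..m}. m + 2 \<le> a + k}"
  \<comment> \<open>The admissible old letters are the \<open>k - 1\<close> largest ones, or all
    \<open>m\<close> if there are fewer.\<close>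
  have "?L = {Suc (m - min m (k - 1))..m}"
    using assms by auto
  then have L: "card ?L = min m (k - 1)"
    by simp
  have inj: "inj_on (\<lambda>(w, a). w @ [a]) X" "inj_on (\<lambda>w. w @ [m]) Y" for X :: "(nat list \<times> nat) set" and Y
    by (auto simp: inj_on_def)
  have "(\<lambda>(w, a). w @ [a]) ` (words_max k n m \<times> ?L) \<inter> (\<lambda>w. w @ [m]) ` words_max k n (m - 1) = {}"
    if "m \<noteq> 0"
    using that by (auto simp: words_max_def)
  then show ?thesis
    using L finite_words_max[OF assms]
    by (auto simp: words_max_Suc[OF assms] card_Un_disjoint card_image[OF inj(1)]
        card_image[OF inj(2)] card_cartesian_product)
qed

lemma words_max_empty: "n < m \<Longrightarrow> words_max k n m = {}"
proof (rule equals0I)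
  fix w assume "n < m" "w \<in> words_max k n m"
  then show False
    using card_length[of w] by (simp add: words_max_def avoiding_words_def)
qed

lemma card_avoiding_words:
  assumes "k \<ge> 1"
  shows "card (avoiding_words k n) = (\<Sum>m\<le>n. card (words_max k n m))"
proof -
  have "card (set w) \<le> n" if "w \<in> avoiding_words k n" for w
    using that card_length[of w] by (simp add: avoiding_words_def)
  then have "avoiding_words k n = (\<Union>m\<le>n. words_max k n m)"
    by (auto simp: words_max_def)
  moreover have "words_max k n l \<inter> words_max k n m = {}" if "l \<noteq> m" for l m
    using that by (auto simp: words_max_def)
  ultimately show ?thesis
    using card_UN_disjoint[of "{..n}" "words_max k n"] finite_words_max[OF assms] by simp
qed

lemma fps_nth_one_minus_mult:
  "fps_nth ((1 - of_nat q * fps_X) * f) (Suc n) = fps_nth f (Suc n) - of_nat q * fps_nth f n"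
  for f :: "'a :: comm_ring_1 fps"
  by (simp add: left_diff_distrib mult.assoc)

definition max_fps :: "nat \<Rightarrow> nat \<Rightarrow> rat fps" where
  "max_fps k m = Abs_fps (\<lambda>n. of_nat (card (words_max k n m)))"

lemma max_fps_0: "k \<ge> 1 \<Longrightarrow> max_fps k 0 = 1"
proof -
  assume k: "k \<ge> 1"
  have "card (words_max k n 0) = (if n = 0 then 1 else 0)" for n
    using k by (cases n) (simp_all add: words_max_0 card_words_max_Suc)
  then show ?thesis
    by (auto simp: max_fps_def fps_eq_iff)
qed

text \<open>With fewer than \<open>k\<close> letters the pattern cannot occur, so every old letter
  may be repeated: this is the recurrence of the Stirling numbers of the second kind.\<close>

lemma max_fps_Suc:
  assumes "Suc m < k"
  shows "(1 - of_nat (Suc m) * fps_X) * max_fps k (Suc m) = fps_X * max_fps k m"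
proof (rule fps_ext)
  fix n
  show "fps_nth ((1 - of_nat (Suc m) * fps_X) * max_fps k (Suc m)) n = fps_nth (fps_X * max_fps k m) n"
    using assms
    by (cases n) (simp_all add: max_fps_def left_diff_distrib mult.assoc words_max_0
        card_words_max_Suc min_absorb1 algebra_simps)
qed

lemma prod_max_fps:
  assumes "m < k"
  shows "(\<Prod>s\<in>{1..m}. (1 - of_nat s * fps_X)) * max_fps k m = fps_X ^ m"
  using assms
proof (induction m)
  case 0
  then show ?case by (simp add: max_fps_0)
next
  case (Suc m)
  have "(\<Prod>s\<in>{1..Suc m}. (1 - of_nat s * fps_X)) * max_fps k (Suc m) =
      (\<Prod>s\<in>{1..m}. (1 - of_nat s * fps_X)) * ((1 - of_nat (Suc m) * fps_X) * max_fps k (Suc m))"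
    by (simp add: mult_ac)
  also have "\<dots> = fps_X * ((\<Prod>s\<in>{1..m}. (1 - of_nat s * fps_X)) * max_fps k m)"
    by (simp only: max_fps_Suc[OF Suc.prems] mult.left_commute)
  also have "\<dots> = fps_X ^ Suc m"
    using Suc by simp
  finally show ?case .
qed

text \<open>Over the common denominator, the \<open>i\<close>-th series contributes
  \<open>fps_X ^ i\<close> times the uncancelled factors with \<open>s > i\<close>, which is a
  summand of the weighted sum.\<close>

lemma prod_sum_max_fps:
  assumes "m < k"
  shows "(\<Prod>s\<in>{1..m}. (1 - of_nat s * fps_X)) * (\<Sum>i\<le>m. max_fps k i) =
    weighted_sum (\<lambda>i. fps_X ^ i) m"
  using assms
proof (induction m)
  case 0
  then show ?case by (simp add: max_fps_0)
next
  case (Suc m)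
  have "(\<Prod>s\<in>{1..Suc m}. (1 - of_nat s * fps_X)) * (\<Sum>i\<le>Suc m. max_fps k i) =
      (1 - of_nat (Suc m) * fps_X) * ((\<Prod>s\<in>{1..m}. (1 - of_nat s * fps_X)) * (\<Sum>i\<le>m. max_fps k i)) +
      (\<Prod>s\<in>{1..Suc m}. (1 - of_nat s * fps_X)) * max_fps k (Suc m)"
    by (simp add: algebra_simps)
  also have "\<dots> = weighted_sum (\<lambda>i. fps_X ^ i) (Suc m)"
    using Suc by (simp only: prod_max_fps weighted_sum_Suc Suc_lessD)
  finally show ?case .
qed

text \<open>Once the maximal letter is at least \<open>k - 1\<close>, there are \<open>k - 1\<close> old letters and one new
  letter to choose from, so all these maximal letters can be treated together.\<close>
lemma large_max_fps:
  fixes p :: nat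
  defines "T \<equiv> Abs_fps (\<lambda>n. of_nat (\<Sum>m=Suc p..n. card (words_max (p+2) n m))) :: rat fps"
  shows "(1 - of_nat (p+2) * fps_X) * T = fps_X * max_fps (p+2) p"
proof -
  have k: "1 \<le> p + 2"
    by simp
  let ?c = "\<lambda>n m. card (words_max (p+2) n m)"
  \<comment> \<open>Here \<open>p + 2\<close> counts \<open>p + 1 = k - 1\<close> old letters and
    one new letter; the extra term counts the words whose maximum has just risen from
    \<open>p\<close> to \<open>p + 1\<close>.\<close>
  have rec: "(\<Sum>m=Suc p..Suc n. ?c (Suc n) m) = (p+2) * (\<Sum>m=Suc p..n. ?c n m) + ?c n p" for n
  proof -
    have "(\<Sum>m=Suc p..Suc n. ?c (Suc n) m) =
        (\<Sum>m=Suc p..Suc n. Suc p * ?c n m + ?c n (m - 1))"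
    proof (rule sum.cong[OF refl])
      fix m assume "m \<in> {Suc p..Suc n}"
      then show "?c (Suc n) m = Suc p * ?c n m + ?c n (m - 1)"
        using card_words_max_Suc[OF k, of n m] by (simp add: min_absorb2)
    qed
    also have "\<dots> = Suc p * (\<Sum>m=Suc p..Suc n. ?c n m) + (\<Sum>m=Suc p..Suc n. ?c n (m - 1))"
      unfolding sum.distrib sum_distrib_left ..
    also have "(\<Sum>m=Suc p..Suc n. ?c n m) = (\<Sum>m=Suc p..n. ?c n m)"
      by (simp add: words_max_empty)
    also have "(\<Sum>m=Suc p..Suc n. ?c n (m - 1)) = (\<Sum>m=p..n. ?c n m)"
      by (subst sum.shift_bounds_cl_Suc_ivl) simp
    \<comment> \<open>For \<open>n < p\<close> the sums are empty and no word of length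
      \<open>n\<close> has maximum \<open>p\<close>.\<close>
    also have "(\<Sum>m=p..n. ?c n m) = ?c n p + (\<Sum>m=Suc p..n. ?c n m)"
      by (cases "p \<le> n") (simp_all add: sum.atLeast_Suc_atMost words_max_empty)
    finally show ?thesis
      by simp
  qed
  show ?thesis
  proof (rule fps_ext)
    fix n
    show "fps_nth ((1 - of_nat (p+2) * fps_X) * T) n = fps_nth (fps_X * max_fps (p+2) p) n"
    proof (cases n)
      case (Suc n')
      show ?thesis
        unfolding Suc T_def max_fps_def
        by (simp only: fps_nth_one_minus_mult fps_nth_Abs_fps rec) (simp add: algebra_simps)
    qed (simp_all add: T_def left_diff_distrib mult.assoc)
  qed
qed

section \<open>Transfer to partitions and the final quotient\<close>

lemma card_noncrossing_k1: "card (noncrossing_k1 k n) = card (avoiding_words k n)"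
proof -
  define \<tau> where "\<tau> = [1..<k+1] @ [1]"
  have image: "canonical_form n ` {P. partition_on {1..n} P} = {w. length w = n \<and> restricted_growth w}"
    by (rule bij_betw_imp_surj_on[OF bij_betw_canonical_form])
  have "avoiding_words k n = {w \<in> {w. length w = n \<and> restricted_growth w}. avoids w \<tau>}"
    by (auto simp only: avoiding_words_def \<tau>_def)
  also have "\<dots> = canonical_form n ` noncrossing_k1 k n"
    unfolding image[symmetric] noncrossing_k1_def \<tau>_def[symmetric] by auto
  finally have "avoiding_words k n = canonical_form n ` noncrossing_k1 k n" .
  moreover have "inj_on (canonical_form n) (noncrossing_k1 k n)"
    by (rule inj_on_subset[OF inj_on_canonical_form]) (auto simp only: noncrossing_k1_def)
  ultimately show ?thesis
    by (simp only: card_image)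
qed

theorem theorem2:
  fixes k :: nat
  assumes "k \<ge> 2"
  shows "Abs_fps (\<lambda>n. of_nat (card (noncrossing_k1 k n)) :: rat) =
    (1 - fps_X
       + (1 - fps_X) * (\<Sum>j=1..k-2. \<Sum>i=0..j. (-1)^(i+j) * fps_X^i * \<beta> i j)
       + (\<Sum>i=0..k-1. (-1)^(i+k-1) * fps_X^i * \<beta> i (k-1)))
    / (1 - fps_X
       - fps_X * (1 - fps_X) * (\<Sum>j=1..k-2. \<Sum>i=0..j. (-1)^(i+j) * of_nat i * \<beta> i j)
       - fps_X * (\<Sum>i=0..k-1. (-1)^(i+k-1) * of_nat i * \<beta> i (k-1)))"
    (is "?F = ?N / ?D")
proof -
  define p where "p = k - 2"
  have k: "k = p + 2"
    using assms by (simp add: p_def)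
  define P where "P j = (\<Prod>s\<in>{1..j}. (1 - of_nat s * fps_X :: rat fps))" for j
  define Q where "Q = weighted_sum (\<lambda>i. fps_X ^ i)"
  define T where "T = Abs_fps (\<lambda>n. of_nat (\<Sum>m=Suc p..n. card (words_max k n m)) :: rat)"
  have P_Suc: "P (Suc p) = (1 - of_nat (Suc p) * fps_X) * P p"
    by (simp add: P_def mult.commute)
  have sign: "(-1 :: rat fps)^(i + k - 1) = (-1)^(i + Suc p)" "k - 1 = Suc p" "k - 2 = p" for i
    by (simp_all add: k)
  have "?D = 1 - fps_X - (1 - fps_X) * (fps_X * weighted_sum of_nat p)
      - (fps_X * weighted_sum of_nat (Suc p) - fps_X * weighted_sum of_nat p)"
    unfolding sign signed_beta_sum signed_beta_double_sum by (simp add: algebra_simps)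
  \<comment> \<open>Each x R_j is replaced by 1 - \<open>P j\<close>.\<close>
  also have "\<dots> = P (Suc p) - fps_X * P p"
    unfolding weighted_sum_of_nat P_def[symmetric] by (simp add: algebra_simps)
  also have "\<dots> = (1 - of_nat (p + 2) * fps_X) * P p"
    by (simp add: P_Suc algebra_simps)
  finally have D: "?D = (1 - of_nat (p + 2) * fps_X) * P p" .
  \<comment> \<open>The leftover R_0 = 1 of the telescoped double sum cancels the leading
    \<open>1 - fps_X\<close>.\<close>
  have N: "?N = (1 - of_nat (p + 2) * fps_X) * Q p + fps_X ^ Suc p"
    unfolding sign signed_beta_sum signed_beta_double_sum Q_def weighted_sum_Suc
    by (simp add: algebra_simps)
  have F: "?F = (\<Sum>m\<le>p. max_fps k m) + T"
  proof (rule fps_ext)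
    fix n
    \<comment> \<open>Padding with zero terms up to \<open>max n p\<close> lets the sum be split at
      \<open>p\<close> even when \<open>n < p\<close>.\<close>
    have "(\<Sum>m\<le>n. card (words_max k n m)) = (\<Sum>m\<le>max n p. card (words_max k n m))"
      by (rule sum.mono_neutral_left) (auto simp: words_max_empty)
    also have "{..max n p} = {..p} \<union> {Suc p..n}"
      by auto
    also have "(\<Sum>m\<in>{..p} \<union> {Suc p..n}. card (words_max k n m)) =
        (\<Sum>m\<le>p. card (words_max k n m)) + (\<Sum>m=Suc p..n. card (words_max k n m))"
      by (rule sum.union_disjoint) auto
    finally have "card (noncrossing_k1 k n) =
        (\<Sum>m\<le>p. card (words_max k n m)) + (\<Sum>m=Suc p..n. card (words_max k n m))"
      using assms by (simp add: card_noncrossing_k1 card_avoiding_words)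
    then show "fps_nth ?F n = fps_nth ((\<Sum>m\<le>p. max_fps k m) + T) n"
      by (simp add: T_def max_fps_def fps_sum_nth)
  qed
  have T: "(1 - of_nat (p + 2) * fps_X) * T = fps_X * max_fps k p"
    unfolding T_def k by (rule large_max_fps)
  have P: "P p * (\<Sum>m\<le>p. max_fps k m) = Q p" "P p * max_fps k p = fps_X ^ p"
    unfolding P_def Q_def by (rule prod_sum_max_fps prod_max_fps; simp add: k)+
  \<comment> \<open>The two factors of the denominator act separately: \<open>P p\<close> clears the
    small maxima, the linear factor clears \<open>T\<close>.\<close>
  have "a * b * (s + t) = a * (b * s) + b * (a * t)" for a b s t :: "rat fps"
    by (simp add: algebra_simps)
  then have "?D * ?F = (1 - of_nat (p + 2) * fps_X) * (P p * (\<Sum>m\<le>p. max_fps k m)) +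
      P p * ((1 - of_nat (p + 2) * fps_X) * T)"
    unfolding D F .
  also have "\<dots> = ?N"
    unfolding T N P by (simp only: mult.left_commute P power_Suc)
  finally have eq: "?D * ?F = ?N" .
  \<comment> \<open>The constant coefficient is 1 whatever the sums are, so they are kept
    abstract.\<close>
  have nonzero: "1 - fps_X - fps_X * a * b - fps_X * c \<noteq> 0" for a b c :: "rat fps"
  proof
    assume "1 - fps_X - fps_X * a * b - fps_X * c = 0"
    then have "fps_nth (1 - fps_X - fps_X * a * b - fps_X * c) 0 = 0"
      by simp
    then show False
      by simp
  qed
  have quotient: "f = n / d" if "d * f = n" "d \<noteq> 0" for d f n :: "rat fps"
    using that by auto
  show ?thesis
    by (rule quotient[OF eq nonzero])
qed

end
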